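(* Let $E$ be a finite set, $e\in E$, and let $S\subseteq 2^E$ have $e$ as a frame, meaning: $\emptyset\in S$, $\{e\}\notin S$, and $e\in Y$ for every nonempty $Y\in S$. Let $S\setminus e:=\{Y\setminus\{e\}\mid Y\in S\}\subseteq 2^{E\setminus\{e\}}$. Then $S\setminus e$ is a powerful set (with ground set $E\setminus\{e\}$) if and only if $S$ is a powerful set.
   Context: For a finite ground set $E$, a family $S\subseteq 2^E$ is called a powerful set if for every $X\subseteq E$ the number of members $Y\in S$ with $Y\cap X=\emptyset$ is a power of $2$. *)

theory Defs
  imports Main
begin

definition powerful_set :: "'a set \<Rightarrow> 'a set set \<Rightarrow> bool" where
  "powerful_set E S \<longleftrightarrow>
     finite E \<and> S \<subseteq> Pow E \<and>
     (\<forall>X. X \<subseteq> E \<longrightarrow> (\<exists>k::nat. card {Y \<in> S. Y \<inter> X = {}} = 2 ^ k))"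

definition is_frame :: "'a \<Rightarrow> 'a set set \<Rightarrow> bool" where
  "is_frame e S \<longleftrightarrow> {} \<in> S \<and> {e} \<notin> S \<and> (\<forall>Y\<in>S. Y \<noteq> {} \<longrightarrow> e \<in> Y)"

definition remove_elem :: "'a set set \<Rightarrow> 'a \<Rightarrow> 'a set set" where
  "remove_elem S e = {Y - {e} | Y. Y \<in> S}"

end

theory Submission
  imports Defs
begin

text \<open>Deleting a frame \<open>e\<close> is injective on \<open>S\<close>, so for \<open>X\<close> avoiding \<open>e\<close> the members of \<open>S\<close> and
  of \<open>S \ e\<close> disjoint from \<open>X\<close> are equinumerous; if \<open>X\<close> contains \<open>e\<close>, only the empty set
  is disjoint from \<open>X\<close>, which gives the count \<open>2 ^ 0\<close>.\<close>

text \<open>Reinserting \<open>e\<close> undoes the deletion on every nonempty member; the empty set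
  needs its own branch in the inverse, since it does not contain \<open>e\<close>.\<close>

lemma inj_on_remove_frame:
  assumes "is_frame e S"
  shows "inj_on (\<lambda>Y. Y - {e}) S"
proof (rule inj_on_inverseI[where g = "\<lambda>Z. if Z = {} then {} else insert e Z"])
  fix Y
  assume "Y \<in> S"
  \<comment> \<open>If \<open>Y\<close> is nonempty but \<open>Y - {e}\<close> is empty, then
    \<open>Y = {e}\<close>, which a frame excludes.\<close>
  then show "(if Y - {e} = {} then {} else insert e (Y - {e})) = Y"
    using assms by (cases "Y = {}") (auto simp: is_frame_def insert_absorb dest: subset_singletonD)
qed

lemma card_disjoint_remove_frame:
  assumes "is_frame e S" and "e \<notin> X"
  shows "card {Y \<in> remove_elem S e. Y \<inter> X = {}} = card {Y \<in> S. Y \<inter> X = {}}"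
proof -
  \<comment> \<open>Since \<open>e \<notin> X\<close>, the sets \<open>Y\<close> and
    \<open>Y - {e}\<close> meet \<open>X\<close> in the same set.\<close>
  have "{Y \<in> remove_elem S e. Y \<inter> X = {}} = (\<lambda>Y. Y - {e}) ` {Y \<in> S. Y \<inter> X = {}}"
    using assms(2) by (auto simp: remove_elem_def)
  moreover have "inj_on (\<lambda>Y. Y - {e}) {Y \<in> S. Y \<inter> X = {}}"
    using inj_on_remove_frame[OF assms(1)] by (rule inj_on_subset) blast
  ultimately show ?thesis
    by (simp add: card_image)
qed

lemma card_disjoint_frame:
  assumes "is_frame e S" and "e \<in> X"
  shows "card {Y \<in> S. Y \<inter> X = {}} = 1"
proof -
  \<comment> \<open>Every nonempty member of \<open>S\<close> shares \<open>e\<close> with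
    \<open>X\<close>.\<close>
  have "{Y \<in> S. Y \<inter> X = {}} = {{}}"
    using assms by (auto simp: is_frame_def)
  then show ?thesis
    by simp
qed

theorem theorem4:
  fixes E :: "'a set" and S :: "'a set set" and e :: 'a
  assumes "finite E" and "e \<in> E" and "S \<subseteq> Pow E" and "is_frame e S"
  shows "powerful_set (E - {e}) (remove_elem S e) \<longleftrightarrow> powerful_set E S"
proof
  assume pow: "powerful_set (E - {e}) (remove_elem S e)"
  have "\<exists>k::nat. card {Y \<in> S. Y \<inter> X = {}} = 2 ^ k" if "X \<subseteq> E" for X
  proof (cases "e \<in> X")
    case True
    then have "card {Y \<in> S. Y \<inter> X = {}} = 2 ^ 0"
      using card_disjoint_frame[OF assms(4)] by simp
    then show ?thesis ..
  next
    case False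
    then have "X \<subseteq> E - {e}"
      using that by blast
    \<comment> \<open>The equality of counts is used from right to left, because \<open>pow\<close>
      counts in \<open>remove_elem S e\<close>.\<close>
    then show ?thesis
      using pow by (simp add: powerful_set_def flip: card_disjoint_remove_frame[OF assms(4) False])
  qed
  with assms show "powerful_set E S"
    by (simp add: powerful_set_def)
next
  assume pow: "powerful_set E S"
  have "\<exists>k::nat. card {Y \<in> remove_elem S e. Y \<inter> X = {}} = 2 ^ k" if "X \<subseteq> E - {e}" for X
  proof -
    have "e \<notin> X" "X \<subseteq> E"
      using that by blast+
    then show ?thesis
      using pow by (simp add: powerful_set_def card_disjoint_remove_frame[OF assms(4)])
  qed
  moreover have "remove_elem S e \<subseteq> Pow (E - {e})"
    using assms(3) unfolding remove_elem_def by blast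
  ultimately show "powerful_set (E - {e}) (remove_elem S e)"
    using assms(1) by (simp add: powerful_set_def)
qed

end
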